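(* Let $0<\theta<1$ be fixed. There exist constants $\underline{a}$ and $y_0$ such that for every pair of real numbers $(x,y)$ with $y>y_0$ and $$\exp\{(\ln y)^{1-\theta}\}<\ln x<\sqrt{y},$$ we have $$\frac{\ln \psi(x,y)}{\ln x}>1-\frac{\ln^{(2)}x+\ln^{(3)}x+\ln^{(4)}x}{\ln y}+\frac{\underline{a}+\ln^{(2)}y+\ln^{(3)}y}{\ln y}.$$
   Context: For positive reals $x,y$, $\psi(x,y)$ denotes the number of integers $2\le k\le x$ whose largest prime divisor does not exceed $y$. The iterated logarithm is $\ln^{(1)}x=\ln x$, $\ln^{(k+1)}x=\ln(\ln^{(k)}x)$ for $k\ge1$ (defined for $x$ sufficiently large). *)

theory Defs
  imports Complex_Main "HOL-Computational_Algebra.Primes"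
begin

definition smooth_count :: "real \<Rightarrow> real \<Rightarrow> nat" (\<open>\<psi>\<close>) where
  "\<psi> x y = card {k :: nat. 2 \<le> k \<and> real k \<le> x \<and> real (Max (prime_factors k)) \<le> y}"

(* The iterated logarithm is meant for k \<ge> 1 and x large enough that every intermediate
   logarithm is positive; elsewhere the value comes from the total function ln. *)
definition iter_ln :: "nat \<Rightarrow> real \<Rightarrow> real" where
  "iter_ln k x = (ln ^^ k) x"

end

theory Submission
  imports Defs "HOL-Number_Theory.Prime_Powers" "HOL-Analysis.Harmonic_Numbers" "HOL-Real_Asymp.Real_Asymp"
begin

text \<open>
  Put \<open>L = ln y\<close>, \<open>w = ln (ln x)\<close> and \<open>u = ln x / L\<close>. Split the primes in \<open>(y / 16 ^ J, y]\<close> with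
  \<open>J \<approx> L / w\<close> into the \<open>J\<close> shells \<open>(Z / 16, Z]\<close>, \<open>Z = y / 16 ^ j\<close>; by Chebyshev's estimates each
  contains at least \<open>Z / (5 * L)\<close> primes. Choosing \<open>K\<close> primes from every shell, with \<open>K\<close> as large as
  possible subject to \<open>\<Prod>Z ^ K \<le> x\<close>, yields at least
  \<open>\<Prod>(Z / (5 * L * K)) ^ K = (\<Prod>Z ^ K) / (5 * L * K) ^ (K * J)\<close> smooth numbers. Here
  \<open>K * J = u * (1 + O(1 / w))\<close> and \<open>L * K = O(u * w)\<close>, so the logarithmic loss is
  \<open>u * (ln u + ln w + O(1))\<close>. Using primes near \<open>y\<close> only would replace \<open>ln w\<close> by \<open>ln L\<close>, which is too
  weak. Finally \<open>ln w > (1 - \<theta>) * ln L\<close>, so \<open>ln (ln w) - ln (ln L)\<close> is bounded below by a constant.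
\<close>

section \<open>Chebyshev's bounds for the summatory von Mangoldt function\<close>

definition chebyshev_psi :: "nat \<Rightarrow> real" where
  "chebyshev_psi n = (\<Sum>d\<in>{1..n}. mangoldt d)"

lemma chebyshev_psi_mono: "m \<le> n \<Longrightarrow> chebyshev_psi m \<le> chebyshev_psi n"
  unfolding chebyshev_psi_def by (intro sum_mono2) (auto simp: mangoldt_nonneg)

lemma chebyshev_psi_split:
  assumes "m \<le> n"
  shows "chebyshev_psi n = chebyshev_psi m + (\<Sum>d\<in>{m<..n}. mangoldt d)"
  unfolding chebyshev_psi_def using assms
  by (subst sum.union_disjoint [symmetric]) (auto intro!: sum.cong)

text \<open>Write each \<open>ln k\<close> with \<open>k \<le> n\<close> as the sum of
  \<open>mangoldt d\<close> over \<open>d dvd k\<close>; then \<open>d\<close> occurs once for each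
  multiple of \<open>d\<close> up to \<open>n\<close>. The free bound \<open>N\<close> lets the sums
  for \<open>n\<close> and \<open>2 * n\<close> share one index set.\<close>

lemma ln_fact_eq_sum_mangoldt:
  assumes "n \<le> N"
  shows "ln (fact n :: real) = (\<Sum>d\<in>{1..N}. mangoldt d * real (n div d))"
  using assms
proof (induction n)
  case 0
  then show ?case by simp
next
  case (Suc n)
  have "Suc n div d = n div d + (if d dvd Suc n then 1 else 0)" for d
    by (simp add: div_Suc dvd_eq_mod_eq_0)
  then have "(\<Sum>d\<in>{1..N}. mangoldt d * real (Suc n div d))
      = (\<Sum>d\<in>{1..N}. mangoldt d * real (n div d)) + (\<Sum>d\<in>{1..N}. if d dvd Suc n then mangoldt d else 0)"
    by (simp add: sum.distrib [symmetric] algebra_simps) (intro sum.cong, auto simp: algebra_simps)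
  also have "(\<Sum>d\<in>{1..N}. if d dvd Suc n then mangoldt d else 0) = (\<Sum>d | d dvd Suc n. mangoldt d :: real)"
    using Suc.prems by (subst sum.inter_filter [symmetric]) (auto intro!: sum.cong dest: dvd_imp_le simp: Suc_le_eq intro: Nat.gr0I)
  also have "\<dots> = ln (real (Suc n))"
    using mangoldt_sum [of "Suc n", where ?'a = real] by simp
  finally show ?case
    using Suc by (simp add: ln_mult)
qed

lemma ln_central_binomial:
  "ln (real (2 * n choose n))
     = (\<Sum>d\<in>{1..2*n}. mangoldt d * (real (2 * n div d) - 2 * real (n div d)))"
proof -
  have "real (2 * n choose n) = fact (2 * n) / (fact n * fact n)"
    by (subst binomial_fact) auto
  then have "ln (real (2 * n choose n)) = ln (fact (2 * n)) - 2 * ln (fact n)"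
    by (simp add: ln_div ln_mult)
  also have "\<dots> = (\<Sum>d\<in>{1..2*n}. mangoldt d * real (2 * n div d))
      - 2 * (\<Sum>d\<in>{1..2*n}. mangoldt d * real (n div d))"
    using ln_fact_eq_sum_mangoldt [of "2 * n" "2 * n"] ln_fact_eq_sum_mangoldt [of n "2 * n"] by simp
  finally show ?thesis
    by (simp add: sum_subtractf sum_distrib_left right_diff_distrib mult.left_commute)
qed

text \<open>Each coefficient \<open>2 * n div d - 2 * (n div d)\<close> is at most 1, since doubling
  a remainder below \<open>d\<close> carries at most once.\<close>

lemma ln_central_binomial_le: "ln (real (2 * n choose n)) \<le> chebyshev_psi (2 * n)"
  unfolding ln_central_binomial chebyshev_psi_def
proof (rule sum_mono)
  fix d assume "d \<in> {1..2*n}"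
  then have "n < d * Suc (n div d)" using dividend_less_times_div [of d n] by simp
  then have "2 * n < (2 * (n div d) + 2) * d" by (simp add: algebra_simps)
  then have "2 * n div d < 2 * (n div d) + 2" by (rule less_mult_imp_div_less)
  then have "real (2 * n div d) - 2 * real (n div d) \<le> 1" by linarith
  then show "mangoldt d * (real (2 * n div d) - 2 * real (n div d)) \<le> mangoldt d"
    by (rule mult_left_le [OF _ mangoldt_nonneg])
qed

text \<open>For \<open>n < d \<le> 2 * n\<close> the coefficient of \<open>mangoldt d\<close> is at
  least 1, because \<open>n div d = 0\<close>; the remaining coefficients are nonnegative and can be
  added.\<close>

lemma chebyshev_psi_double_le: "chebyshev_psi (2 * n) - chebyshev_psi n \<le> ln (real (2 * n choose n))"
proof -
  have "chebyshev_psi (2 * n) = chebyshev_psi n + (\<Sum>d\<in>{n<..2*n}. mangoldt d)"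
    by (rule chebyshev_psi_split) simp
  moreover have "(\<Sum>d\<in>{n<..2*n}. mangoldt d)
      \<le> (\<Sum>d\<in>{n<..2*n}. mangoldt d * (real (2 * n div d) - 2 * real (n div d)))"
  proof (rule sum_mono)
    fix d assume d: "d \<in> {n<..2*n}"
    then have "1 \<le> 2 * n div d" using div_le_mono [of d "2 * n" d] by auto
    moreover have "n div d = 0" using d by simp
    ultimately show "mangoldt d \<le> mangoldt d * (real (2 * n div d) - 2 * real (n div d))"
      using mult_left_mono [of 1 "real (2 * n div d)" "mangoldt d"] by (simp add: mangoldt_nonneg)
  qed
  moreover have "\<dots> \<le> ln (real (2 * n choose n))"
    unfolding ln_central_binomial
  proof (rule sum_mono2)
    fix d
    have "2 * (n div d) \<le> 2 * n div d"
      using div_add1_eq [of n n d] by (simp flip: mult_2)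
    then show "0 \<le> mangoldt d * (real (2 * n div d) - 2 * real (n div d))"
      by (intro mult_nonneg_nonneg mangoldt_nonneg) linarith
  qed auto
  ultimately show ?thesis by linarith
qed

text \<open>Halving induction: passing from about \<open>n / 2\<close> to \<open>n\<close> costs at
  most the logarithm of a central binomial coefficient, and these costs form a geometric
  series.\<close>

lemma chebyshev_psi_le: "chebyshev_psi n \<le> 3 * real n"
proof -
  have "chebyshev_psi n \<le> 4 * real n * ln 2"
  proof (induction n rule: less_induct)
    case (less n)
    consider "n = 0" | "n = 1" | "n = 2" | "n \<ge> 3" by linarith
    then show ?case
    proof cases
      case 4
      define m where "m = (n + 1) div 2"
      have m: "n \<le> 2 * m" "2 * m \<le> n + 1" "m < n" using 4 by (auto simp: m_def)
      have "chebyshev_psi n \<le> chebyshev_psi (2 * m)" by (rule chebyshev_psi_mono) (use m in auto)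
      also have "\<dots> \<le> chebyshev_psi m + ln (real (2 * m choose m))"
        using chebyshev_psi_double_le [of m] by simp
      also have "ln (real (2 * m choose m)) \<le> ln (2 ^ (2 * m))"
        using binomial_le_pow2 [of "2 * m" m]
        by (subst ln_le_cancel_iff) (auto simp: numeral_power_le_of_nat_cancel_iff of_nat_le_numeral_power_cancel_iff)
      also have "\<dots> = 2 * real m * ln 2" by (subst ln_realpow) auto
      also have "chebyshev_psi m + \<dots> \<le> 4 * real m * ln 2 + 2 * real m * ln 2"
        using less.IH [of m] m by simp
      also have "\<dots> = 6 * real m * ln 2" by simp
      \<comment> \<open>Here \<open>6 * m \<le> 3 * (n + 1) \<le> 4 * n\<close>, the last inequality
        by \<open>n \<ge> 3\<close>; the smaller \<open>n\<close> are treated separately.\<close>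
      also have "\<dots> \<le> 4 * real n * ln 2" using m 4 by (intro mult_right_mono) auto
      finally show ?thesis by simp
    next
      case 3
      have "chebyshev_psi 2 = ln 2"
        using mangoldt_prime [OF two_is_prime_nat, where ?'a = real]
        by (simp add: chebyshev_psi_def eval_nat_numeral)
      then show ?thesis using 3 by simp
    qed (auto simp: chebyshev_psi_def)
  qed
  also have "\<dots> = real n * (4 * ln 2)" by simp
  also have "\<dots> \<le> real n * 3" using ln2_le_25_over_36 by (intro mult_left_mono) auto
  also have "\<dots> = 3 * real n" by simp
  finally show ?thesis .
qed

text \<open>Uses that the middle coefficient of row \<open>2 * m\<close> is at least
  \<open>4 ^ m / (2 * m)\<close>; the loss of \<open>ln 2\<close> covers odd
  \<open>n\<close>.\<close>

lemma chebyshev_psi_ge: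
  assumes "n \<ge> 2"
  shows "(real n - 1) * ln 2 - ln (real n) \<le> chebyshev_psi n"
proof -
  define m where "m = n div 2"
  have m: "2 * m \<le> n" "n \<le> 2 * m + 1" "m > 0" using assms by (auto simp: m_def)
  have "(real n - 1) * ln 2 - ln (real n) \<le> (2 * real m) * ln 2 - ln (2 * real m)"
    using m by (intro diff_mono mult_right_mono) (auto simp: ln_le_cancel_iff)
  also have "\<dots> = ln (4 ^ m / (2 * real m))"
    using m ln_realpow [of 2 "2 * m"] by (simp add: ln_div power_mult)
  also have "\<dots> \<le> ln (real (2 * m choose m))"
    using central_binomial_lower_bound [of m] m
    by (subst ln_le_cancel_iff) auto
  also have "\<dots> \<le> chebyshev_psi n"
    using ln_central_binomial_le [of m] chebyshev_psi_mono [OF m(1)] by simp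
  finally show ?thesis .
qed

section \<open>Counting primes in a shell \<open>(z / 16, z]\<close>\<close>

text \<open>A proper power \<open>p ^ k \<le> n\<close> has \<open>k \<ge> 2\<close>, hence
  \<open>p \<le> sqrt n\<close> and \<open>k \<le> log 2 n\<close>; it remains to count the
  pairs.\<close>

lemma card_proper_prime_powers_le:
  assumes "n \<ge> 1"
  shows "real (card {d. primepow d \<and> \<not> prime d \<and> d \<le> n}) \<le> sqrt (real n) * log 2 (real n)"
proof -
  define S :: "(nat \<times> nat) set" where "S = {1..nat \<lfloor>sqrt (real n)\<rfloor>} \<times> {1..nat \<lfloor>log 2 (real n)\<rfloor>}"
  have "{d. primepow d \<and> \<not> prime d \<and> d \<le> n} \<subseteq> (\<lambda>(p, k). p ^ k) ` S"
  proof
    fix d assume "d \<in> {d. primepow d \<and> \<not> prime d \<and> d \<le> n}"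
    then obtain p k where pk: "d = p ^ k" "prime p" "k > 0" and d: "\<not> prime d" "d \<le> n"
      by (auto simp: primepow_def)
    have "k \<noteq> 1" using pk d by auto
    then have k2: "k \<ge> 2" using pk by auto
    have p2: "p \<ge> 2" using pk by (simp add: prime_ge_2_nat)
    have "p ^ 2 \<le> d" using pk k2 p2 by (simp add: power_increasing)
    then have "real p \<le> sqrt (real n)"
      using d by (intro real_le_rsqrt) (metis of_nat_le_iff of_nat_power order_trans)
    moreover have "2 ^ k \<le> n" using pk p2 d by (meson order_trans power_mono zero_le_numeral)
    then have "real k \<le> log 2 (real n)"
      using assms by (simp add: le_log_iff powr_realpow)
    ultimately have "(p, k) \<in> S"
      using p2 k2 by (auto simp: S_def le_nat_floor)
    then show "d \<in> (\<lambda>(p, k). p ^ k) ` S" using pk by auto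
  qed
  then have "card {d. primepow d \<and> \<not> prime d \<and> d \<le> n} \<le> card ((\<lambda>(p, k). p ^ k) ` S)"
    by (intro card_mono) (auto simp: S_def)
  also have "\<dots> \<le> card S" by (rule card_image_le) (auto simp: S_def)
  finally have "real (card {d. primepow d \<and> \<not> prime d \<and> d \<le> n}) \<le> real (card S)" by simp
  also have "\<dots> = real (nat \<lfloor>sqrt (real n)\<rfloor>) * real (nat \<lfloor>log 2 (real n)\<rfloor>)"
    by (simp add: S_def)
  also have "\<dots> \<le> sqrt (real n) * log 2 (real n)"
    using assms by (intro mult_mono) auto
  finally show ?thesis .
qed

text \<open>Only prime powers contribute, each at most \<open>ln n\<close>. Proper powers are
  counted over all of \<open>{..n}\<close>, which is still of lower order.\<close>

lemma chebyshev_psi_diff_le: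
  assumes "m \<le> n" "n \<ge> 1"
  shows "chebyshev_psi n - chebyshev_psi m
           \<le> (real (card {p. prime p \<and> m < p \<and> p \<le> n}) + sqrt (real n) * log 2 (real n)) * ln (real n)"
proof -
  let ?P = "{p. prime p \<and> m < p \<and> p \<le> n}" and ?Q = "{d. primepow d \<and> \<not> prime d \<and> d \<le> n}"
  have "chebyshev_psi n - chebyshev_psi m = (\<Sum>d\<in>{m<..n}. mangoldt d)"
    using chebyshev_psi_split [OF assms(1)] by simp
  also have "\<dots> = (\<Sum>d\<in>{m<..n} \<inter> (?P \<union> ?Q). mangoldt d)"
    by (rule sum.mono_neutral_right) (auto simp: mangoldt_def)
  also have "\<dots> \<le> (\<Sum>d\<in>?P \<union> ?Q. mangoldt d)"
    by (rule sum_mono2) (auto simp: mangoldt_nonneg)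
  also have "\<dots> \<le> (\<Sum>d\<in>?P \<union> ?Q. ln (real n))"
  proof (rule sum_mono)
    fix d assume "d \<in> ?P \<union> ?Q"
    then have "0 < d" "d \<le> n" by (auto simp: prime_gt_0_nat primepow_gt_0_nat)
    then have "mangoldt d \<le> ln (real d)" "ln (real d) \<le> ln (real n)"
      by (auto intro: mangoldt_le)
    then show "mangoldt d \<le> ln (real n)" by (rule order_trans)
  qed
  also have "\<dots> = real (card (?P \<union> ?Q)) * ln (real n)" by simp
  also have "\<dots> \<le> (real (card ?P) + sqrt (real n) * log 2 (real n)) * ln (real n)"
    using card_Un_le [of ?P ?Q] card_proper_prime_powers_le [OF assms(2)] assms
    by (intro mult_right_mono) auto
  finally show ?thesis .
qed

lemma eventually_card_primes_shell_ge:
  "eventually (\<lambda>z::real. z / (5 * ln z) \<le> real (card {p::nat. prime p \<and> z / 16 < real p \<and> real p \<le> z})) at_top"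
proof -
  \<comment> \<open>The ratio 16 makes the upper constant small enough:
    \<open>2 / 3 - 3 / 16 > 1 / 5\<close>, and the gap absorbs all lower-order terms.\<close>
  have "eventually (\<lambda>z::real. z / 5 \<le> (z - 2) * (2 / 3) - ln z - 3 * (z / 16) - sqrt z * log 2 z * ln z) at_top"
    by real_asymp
  moreover have "eventually (\<lambda>z::real. z \<ge> 2) at_top" by (rule eventually_ge_at_top)
  ultimately show ?thesis
  proof eventually_elim
    case (elim z)
    define n m where "n = nat \<lfloor>z\<rfloor>" and "m = nat \<lfloor>z / 16\<rfloor>"
    have n: "n \<ge> 2" "real n \<le> z" "z < real n + 1"
      using elim unfolding n_def by linarith+
    have m: "real m \<le> z / 16" "m \<le> n"
      using elim unfolding n_def m_def by (linarith, intro nat_mono floor_mono) simp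
    have P: "{p. prime p \<and> m < p \<and> p \<le> n} = {p. prime p \<and> z / 16 < real p \<and> real p \<le> z}" (is "_ = ?P")
      using elim by (auto simp: n_def m_def le_nat_iff nat_less_iff le_floor_iff floor_less_iff)
    have "z / 5 \<le> (z - 2) * (2 / 3) - ln z - 3 * (z / 16) - sqrt z * log 2 z * ln z" by (fact elim)
    also have "\<dots> \<le> (z - 2) * ln 2 - ln z - 3 * (z / 16) - sqrt z * log 2 z * ln z"
      using elim ln2_ge_two_thirds by (intro diff_mono mult_left_mono) auto
    also have "\<dots> \<le> (real n - 1) * ln 2 - ln (real n) - 3 * real m - sqrt z * log 2 z * ln z"
    proof -
      have "(z - 2) * ln 2 \<le> (real n - 1) * ln 2" using n by (intro mult_right_mono) auto
      moreover have "ln (real n) \<le> ln z" using n by simp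
      ultimately show ?thesis using m by linarith
    qed
    also have "\<dots> \<le> chebyshev_psi n - chebyshev_psi m - sqrt z * log 2 z * ln z"
      using chebyshev_psi_ge [OF n(1)] chebyshev_psi_le [of m] by simp
    also have "\<dots> \<le> (real (card ?P) + sqrt (real n) * log 2 (real n)) * ln (real n) - sqrt z * log 2 z * ln z"
      using chebyshev_psi_diff_le [OF m(2)] n P by simp
    also have "\<dots> \<le> (real (card ?P) + sqrt z * log 2 z) * ln z - sqrt z * log 2 z * ln z"
      using n elim by (intro diff_mono mult_mono add_mono) auto
    finally have "z / 5 \<le> real (card ?P) * ln z" by (simp add: algebra_simps)
    then show ?case using elim by (simp add: field_simps)
  qed
qed

section \<open>Smooth numbers as products of chosen primes\<close>

text \<open>Every choice of \<open>K\<close> primes from each \<open>P j\<close> has a product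
  counted by \<open>\<psi> x y\<close>. Unique factorisation recovers the set of primes from the
  product, and disjointness recovers the individual choices from that set.\<close>

lemma smooth_count_ge_prod_binomial:
  fixes P :: "nat \<Rightarrow> nat set" and Z :: "nat \<Rightarrow> real"
  assumes fin: "\<And>j. j < J \<Longrightarrow> finite (P j)"
    and disj: "\<And>i j. i < J \<Longrightarrow> j < J \<Longrightarrow> i \<noteq> j \<Longrightarrow> P i \<inter> P j = {}"
    and prime: "\<And>j p. j < J \<Longrightarrow> p \<in> P j \<Longrightarrow> prime p"
    and le_y: "\<And>j p. j < J \<Longrightarrow> p \<in> P j \<Longrightarrow> real p \<le> y"
    and le_Z: "\<And>j p. j < J \<Longrightarrow> p \<in> P j \<Longrightarrow> real p \<le> Z j"
    and pos: "J > 0" "K > 0"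
    and prod_le: "(\<Prod>j<J. Z j ^ K) \<le> x"
  shows "(\<Prod>j<J. card (P j) choose K) \<le> \<psi> x y"
proof -
  define F where "F = (\<Pi>\<^sub>E j\<in>{..<J}. {T. T \<subseteq> P j \<and> card T = K})"
  define U where "U f = (\<Union>j<J. f j)" for f :: "nat \<Rightarrow> nat set"
  define S where "S = {k :: nat. 2 \<le> k \<and> real k \<le> x \<and> real (Max (prime_factors k)) \<le> y}"
  have F: "f j \<subseteq> P j" "card (f j) = K" if "f \<in> F" "j < J" for f j
    using that by (auto simp: F_def PiE_iff)
  have fin_f: "finite (f j)" if "f \<in> F" "j < J" for f j
    using F [OF that] fin [OF that(2)] by (auto intro: finite_subset)
  have fin_U: "finite (U f)" if "f \<in> F" for f
    using fin_f [OF that] by (auto simp: U_def)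
  have U_prime: "prime p" "real p \<le> y" if "f \<in> F" "p \<in> U f" for f p
    using that F(1) [OF that(1)] prime le_y unfolding U_def by blast+
  have factors: "prime_factors (\<Prod>(U f)) = U f" if "f \<in> F" for f
  proof -
    have "prime_factors (\<Prod>p\<in>U f. p) = \<Union> ((prime_factors \<circ> (\<lambda>p. p)) ` U f)"
      using U_prime(1) [OF that] by (intro prime_factors_prod fin_U [OF that]) (auto dest: prime_gt_0_nat)
    also have "\<dots> = U f"
      using U_prime(1) [OF that] by (auto simp: prime_prime_factors)
    finally show ?thesis by simp
  qed
  have recover: "f j = U f \<inter> P j" if "f \<in> F" "j < J" for f j
    using F(1) [OF that(1)] disj that(2) unfolding U_def by fast
  have "inj_on (\<lambda>f. \<Prod>(U f)) F"
  proof (rule inj_onI)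
    fix f g assume fg: "f \<in> F" "g \<in> F" "\<Prod>(U f) = \<Prod>(U g)"
    then have "U f = U g" using factors by metis
    then have "f j = g j" if "j < J" for j
      using recover [OF fg(1) that] recover [OF fg(2) that] by simp
    then show "f = g" using fg(1,2) unfolding F_def by (intro PiE_ext) auto
  qed
  moreover have "(\<lambda>f. \<Prod>(U f)) ` F \<subseteq> S"
  proof
    fix k assume "k \<in> (\<lambda>f. \<Prod>(U f)) ` F"
    then obtain f where f: "f \<in> F" and k: "k = \<Prod>(U f)" by auto
    \<comment> \<open>With \<open>J\<close> and \<open>K\<close> positive the product is not the
      empty one, so it is at least 2 and \<open>Max\<close> is taken over a nonempty set.\<close>
    have "f 0 \<noteq> {}" using F(2) [OF f pos(1)] pos(2) by auto
    then have ne: "U f \<noteq> {}" using pos(1) by (auto simp: U_def)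
    then obtain p where p: "p \<in> prime_factors k" using factors [OF f] k by auto
    then have "p dvd k" "k \<noteq> 0" "2 \<le> p" by (auto simp: in_prime_factors_iff prime_ge_2_nat)
    then have "2 \<le> k" using dvd_imp_le [of p k] by linarith
    moreover have "real k \<le> x"
    proof -
      have "k = (\<Prod>j<J. \<Prod>(f j))"
        unfolding k U_def using fin_f [OF f] F(1) [OF f] disj
        by (intro prod.UNION_disjoint [of _ f "\<lambda>p. p", simplified]) blast+
      then have "real k = (\<Prod>j<J. \<Prod>p\<in>f j. real p)" by simp
      also have "\<dots> \<le> (\<Prod>j<J. \<Prod>p\<in>f j. Z j)"
        using F(1) [OF f] le_Z by (intro prod_mono conjI prod_nonneg) auto
      also have "\<dots> = (\<Prod>j<J. Z j ^ K)" using F(2) [OF f] by simp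
      finally show ?thesis using prod_le by simp
    qed
    moreover have "Max (prime_factors k) \<in> U f"
      using factors [OF f] fin_U [OF f] ne k by (metis Max_in)
    then have "real (Max (prime_factors k)) \<le> y" by (rule U_prime(2) [OF f])
    ultimately show "k \<in> S" by (simp add: S_def)
  qed
  moreover have "finite S"
    by (rule finite_subset [of _ "{..nat \<lfloor>x\<rfloor>}"]) (auto simp: S_def le_nat_floor)
  ultimately have "card F \<le> card S" by (rule card_inj_on_le)
  moreover have "card F = (\<Prod>j<J. card (P j) choose K)"
    unfolding F_def using fin by (simp add: card_PiE n_subsets)
  ultimately show ?thesis by (simp add: smooth_count_def S_def)
qed

section \<open>Choosing the shells and the number of primes per shell\<close>

text \<open>The constant is \<open>14 = 4 + 9 + 1\<close>: 4 from the numerical factor inside the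
  logarithm, 9 from the excess of \<open>K * J\<close> over \<open>u\<close>, and 1 from rounding
  \<open>K\<close> down.\<close>

lemma smooth_count_lower_bound:
  obtains L\<^sub>0 :: real where
    "\<And>x y. \<lbrakk>0 < x; 0 < y; L\<^sub>0 \<le> ln y; 12 \<le> ln (ln x); ln y ^ 3 \<le> ln x; ln x \<le> sqrt y\<rbrakk> \<Longrightarrow>
       ln x - ln x / ln y * (ln (ln x / ln y) + ln (ln (ln x)) + 14) \<le> ln (real (\<psi> x y))"
proof -
  define N where "N z = real (card {p::nat. prime p \<and> z / 16 < real p \<and> real p \<le> z})" for z :: real
  obtain z\<^sub>0 where z\<^sub>0: "\<And>z. z \<ge> z\<^sub>0 \<Longrightarrow> z / (5 * ln z) \<le> N z"
    using eventually_card_primes_shell_ge unfolding N_def eventually_at_top_linorder by blast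
  \<comment> \<open>All shells will have top at least \<open>exp (3 / 4 * L)\<close>. This must
    exceed the shell threshold \<open>z\<^sub>0\<close>, and leave at least \<open>sqrt y\<close>
    primes per shell, hence at least \<open>K\<close>.\<close>
  have "eventually (\<lambda>L::real. z\<^sub>0 \<le> exp (3 / 4 * L)) at_top" by real_asymp
  moreover have "eventually (\<lambda>L::real. 5 * L * exp (L / 2) \<le> exp (3 / 4 * L)) at_top" by real_asymp
  moreover have "eventually (\<lambda>L::real. 1 \<le> L) at_top" by (rule eventually_ge_at_top)
  ultimately have "eventually (\<lambda>L::real. z\<^sub>0 \<le> exp (3 / 4 * L) \<and> 5 * L * exp (L / 2) \<le> exp (3 / 4 * L) \<and> 1 \<le> L) at_top"
    by eventually_elim simp
  then obtain L\<^sub>0 where L\<^sub>0: "\<And>L. L \<ge> L\<^sub>0 \<Longrightarrow> z\<^sub>0 \<le> exp (3 / 4 * L) \<and> 5 * L * exp (L / 2) \<le> exp (3 / 4 * L) \<and> 1 \<le> L"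
    unfolding eventually_at_top_linorder by blast
  show ?thesis
  proof (rule that)
    fix x y :: real
    assume xy: "0 < x" "0 < y" and "L\<^sub>0 \<le> ln y" and w12: "12 \<le> ln (ln x)"
      and cube: "ln y ^ 3 \<le> ln x" and le_sqrt: "ln x \<le> sqrt y"
    define L X w u b where "L = ln y" and "X = ln x" and "w = ln X" and "u = X / L" and "b = ln (16::real)"
    note defs = L_def X_def w_def u_def
    have L: "z\<^sub>0 \<le> exp (3 / 4 * L)" "5 * L * exp (L / 2) \<le> exp (3 / 4 * L)" "1 \<le> L"
      using L\<^sub>0 \<open>L\<^sub>0 \<le> ln y\<close> by (auto simp: L_def)
    have w: "12 \<le> w" using w12 by (simp add: defs)
    have "1 \<le> L ^ 3" using L(3) by (rule one_le_power)
    then have X: "1 \<le> X" "L ^ 3 \<le> X" using cube by (auto simp: defs)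
    have b: "0 < b" "b \<le> 3"
    proof -
      have "b = 4 * ln 2" using ln_realpow [of 2 4] by (simp add: b_def)
      then show "0 < b" "b \<le> 3" using ln2_le_25_over_36 by auto
    qed
    have y_eq: "y = exp L" using xy by (simp add: L_def)
    have sqrt_y: "sqrt y = exp (L / 2)"
      by (rule real_sqrt_unique) (simp_all add: y_eq power2_eq_square flip: exp_add)
    have X_le: "X \<le> exp (L / 2)" using le_sqrt sqrt_y by (simp add: X_def)
    then have "w \<le> L / 2"
      using X(1) ln_mono [of X "exp (L / 2)"] by (simp add: w_def)
    \<comment> \<open>Few enough shells that every \<open>ln (Z j)\<close> is near \<open>L\<close>,
      yet enough that \<open>L \<le> 2 * w * J\<close>; the latter later trades \<open>L\<close> for
      \<open>w\<close>.\<close>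
    define J where "J = nat \<lfloor>L / w\<rfloor>"
    have "2 \<le> L / w" using \<open>w \<le> L / 2\<close> w by (simp add: field_simps)
    then have "2 \<le> \<lfloor>L / w\<rfloor>" by (simp add: le_floor_iff)
    then have "real J = of_int \<lfloor>L / w\<rfloor>" "2 \<le> real J" by (simp_all add: J_def)
    then have J: "2 \<le> real J" "real J \<le> L / w" "L / w < real J + 1" by linarith+
    have Jw: "real J * w \<le> L" using J(2) w by (simp add: field_simps)
    have L_le: "L \<le> 2 * w * real J"
    proof -
      have "L / w \<le> 2 * real J" using J by linarith
      then show ?thesis using w by (simp add: field_simps)
    qed
    define Z where "Z j = exp (L - real j * b)" for j
    define P where "P j = {p::nat. prime p \<and> Z j / 16 < real p \<and> real p \<le> Z j}" for j
    have exp_b: "exp b = 16" by (simp add: b_def)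
    have Z_Suc: "Z (Suc j) = Z j / 16" for j
      by (simp add: Z_def algebra_simps exp_diff exp_b exp_add)
    have Z_mono: "Z j \<le> Z i" if "i \<le> j" for i j
      using that b by (simp add: Z_def mult_right_mono)
    \<comment> \<open>The assumption \<open>12 \<le> w\<close> gives
      \<open>3 * J \<le> L / 4\<close>.\<close>
    have Z_ge: "exp (3 / 4 * L) \<le> Z j" if "j < J" for j
    proof -
      have "real j * b \<le> real J * 3" using that b by (intro mult_mono) auto
      also have "\<dots> \<le> L / 4"
        using mult_left_mono [OF w, of "real J"] Jw by simp
      finally show ?thesis by (simp add: Z_def)
    qed
    have fin_P: "finite (P j)" for j
      by (rule finite_subset [of _ "{..nat \<lfloor>Z j\<rfloor>}"]) (auto simp: P_def le_nat_floor)
    have disj': "P i \<inter> P j = {}" if "i < j" for i j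
      using Z_mono [of "Suc i" j] that by (auto simp: P_def Z_Suc)
    have disj: "P i \<inter> P j = {}" if "i \<noteq> j" for i j
      using disj' [of i j] disj' [of j i] that by (cases i j rule: linorder_cases) auto
    have card_P: "Z j / (5 * L) \<le> real (card (P j))" if "j < J" for j
    proof -
      have "Z j \<ge> z\<^sub>0" using Z_ge [OF that] L by linarith
      then have "Z j / (5 * ln (Z j)) \<le> real (card (P j))" using z\<^sub>0 by (simp add: N_def P_def)
      moreover have "0 < ln (Z j)" "ln (Z j) \<le> L"
      proof -
        have "exp 0 < Z j" using Z_ge [OF that] L(3) by (intro less_le_trans [OF _ Z_ge [OF that]]) simp
        then show "0 < ln (Z j)" by simp
        show "ln (Z j) \<le> L" using b by (simp add: Z_def)
      qed
      then have "Z j / (5 * L) \<le> Z j / (5 * ln (Z j))"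
        by (intro divide_left_mono) (use L(3) in \<open>auto simp: Z_def\<close>)
      ultimately show ?thesis by linarith
    qed
    \<comment> \<open>\<open>exp A\<close> is the product of all \<open>Z j\<close>, so each unit of
      \<open>K\<close> uses up \<open>A\<close> of the available \<open>X = ln x\<close>.\<close>
    define A where "A = (\<Sum>j<J. L - real j * b)"
    have A_le: "A \<le> real J * L"
    proof -
      have "A \<le> (\<Sum>j<J. L)" unfolding A_def using b by (intro sum_mono) simp
      then show ?thesis by simp
    qed
    \<comment> \<open>The shells descend linearly in logarithm: the total deficit is at most
      \<open>b * J^2 / 2\<close>, with \<open>b \<le> 3\<close> and
      \<open>J \<le> L / w\<close>.\<close>
    have A_ge: "real J * L * (1 - 3 / (2 * w)) \<le> A"
    proof -
      have "(\<Sum>j<J. real j) \<le> real J * real J / 2" by (induction J) (auto simp: field_simps)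
      then have "b * (\<Sum>j<J. real j) \<le> 3 * (real J * real J / 2)"
        using b by (intro mult_mono) (auto intro: sum_nonneg)
      also have "\<dots> \<le> 3 * (real J * (L / w) / 2)" using J by (intro mult_left_mono divide_right_mono) auto
      finally show ?thesis
        by (simp add: A_def sum_subtractf sum_distrib_left algebra_simps)
    qed
    have \<delta>: "3 / (2 * w) \<le> 1 / 8" using w by (simp add: field_simps)
    have "1 \<le> A"
    proof -
      have "2 * 1 * (7 / 8) \<le> real J * L * (1 - 3 / (2 * w))"
        using J(1) L(3) \<delta> by (intro mult_mono) auto
      then show ?thesis using A_ge by simp
    qed
    have A_sq: "A \<le> L ^ 2"
    proof -
      have "real J * L \<le> real J * w * L"
        using w L(3) by (intro mult_right_mono) (auto simp: mult_le_cancel_left1)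
      also have "\<dots> \<le> L * L" using Jw L(3) by (intro mult_right_mono) auto
      finally show ?thesis using A_le by (simp add: power2_eq_square)
    qed
    \<comment> \<open>With \<open>A \<le> L ^ 2\<close>, the cubic hypothesis keeps the loss from
      rounding \<open>K\<close>, which is at most \<open>A\<close>, below \<open>u\<close>. It also
      yields \<open>K \<ge> 1\<close>.\<close>
    have sq_le_u: "L ^ 2 \<le> u" using X(2) L(3) by (simp add: u_def field_simps eval_nat_numeral)
    have u: "0 < u" "u \<le> X" using X L(3) by (auto simp: u_def field_simps mult_le_cancel_left1)
    define K where "K = nat \<lfloor>X / A\<rfloor>"
    have "1 \<le> X / A" using \<open>1 \<le> A\<close> A_sq sq_le_u u by (simp add: field_simps)
    then have "1 \<le> \<lfloor>X / A\<rfloor>" by (simp add: le_floor_iff)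
    then have "real K = of_int \<lfloor>X / A\<rfloor>" "1 \<le> real K" by (simp_all add: K_def)
    then have "1 \<le> real K" "real K \<le> X / A" "X / A < real K + 1" by linarith+
    then have K: "1 \<le> real K" "real K * A \<le> X" "X - A \<le> real K * A"
      using \<open>1 \<le> A\<close> by (auto simp: field_simps)
    have K_le: "K \<le> card (P j)" if "j < J" for j
    proof -
      have "real K \<le> real K * A" using K(1) \<open>1 \<le> A\<close> by (simp add: mult_le_cancel_left1)
      also have "\<dots> \<le> exp (L / 2)" using K(2) X_le by linarith
      also have "\<dots> \<le> exp (3 / 4 * L) / (5 * L)" using L by (simp add: field_simps)
      also have "\<dots> \<le> Z j / (5 * L)" using Z_ge [OF that] L(3) by (intro divide_right_mono) auto
      also have "\<dots> \<le> real (card (P j))" by (rule card_P [OF that])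
      finally show ?thesis by simp
    qed
    have prod_Z: "(\<Prod>j<J. Z j ^ K) = exp (real K * A)"
      by (simp add: Z_def A_def sum_distrib_left exp_sum exp_of_nat_mult)
    have "(\<Prod>j<J. card (P j) choose K) \<le> \<psi> x y"
    proof (rule smooth_count_ge_prod_binomial)
      show "(\<Prod>j<J. Z j ^ K) \<le> x"
        using prod_Z K(2) xy by (simp add: X_def flip: ln_ge_iff)
      fix j p assume "j < J" "p \<in> P j"
      moreover have "Z 0 = y" by (simp add: Z_def y_eq)
      ultimately show "real p \<le> y" using Z_mono [of 0 j] by (simp add: P_def)
    qed (use J K fin_P disj in \<open>auto simp: P_def\<close>)
    then have "real (\<Prod>j<J. card (P j) choose K) \<le> real (\<psi> x y)" by (rule of_nat_mono)
    \<comment> \<open>Combines \<open>(n / K) ^ K \<le> n choose K\<close>, valid for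
      \<open>K \<le> n\<close>, with the shell count. The common denominator \<open>5 * L\<close>
      lets the product collapse to powers of \<open>5 * L * K\<close>.\<close>
    moreover have "(\<Prod>j<J. (Z j / (5 * L * real K)) ^ K) \<le> real (\<Prod>j<J. card (P j) choose K)"
      unfolding of_nat_prod
    proof (rule prod_mono, rule conjI)
      fix j assume "j \<in> {..<J}"
      then have j: "j < J" by simp
      show "0 \<le> (Z j / (5 * L * real K)) ^ K" using L(3) by (simp add: Z_def)
      have "Z j / (5 * L * real K) \<le> real (card (P j)) / real K"
        using divide_right_mono [OF card_P [OF j], of "real K"] by simp
      then have "(Z j / (5 * L * real K)) ^ K \<le> (real (card (P j)) / real K) ^ K"
        using L(3) by (intro power_mono) (auto simp: Z_def)
      also have "\<dots> \<le> real (card (P j) choose K)"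
        by (rule binomial_ge_n_over_k_pow_k [OF K_le [OF j]])
      finally show "(Z j / (5 * L * real K)) ^ K \<le> real (card (P j) choose K)" .
    qed
    moreover have "(\<Prod>j<J. (Z j / (5 * L * real K)) ^ K)
        = exp (real K * A - real K * real J * ln (5 * L * real K))"
    proof -
      have "exp (real K * real J * ln (5 * L * real K)) = (5 * L * real K) ^ (K * J)"
        using L(3) K(1) exp_of_nat_mult [of "K * J" "ln (5 * L * real K)"] by simp
      then show ?thesis
        by (simp add: power_divide prod_dividef prod_Z exp_diff power_mult)
    qed
    ultimately have "exp (real K * A - real K * real J * ln (5 * L * real K)) \<le> real (\<psi> x y)"
      by linarith
    then have main: "real K * A - real K * real J * ln (5 * L * real K) \<le> ln (real (\<psi> x y))"
      by (smt (verit) exp_gt_zero ln_ge_iff)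
    \<comment> \<open>From \<open>K * A \<le> X\<close> and the lower bound for \<open>A\<close>.
      With \<open>t = 3 / w \<le> 1\<close>, the factor \<open>1 - t / 2\<close> is inverted by
      \<open>1 \<le> (1 - t / 2) * (1 + t)\<close>.\<close>
    have KJ: "real K * real J \<le> u * (1 + 3 / w)"
    proof -
      have "real K * (real J * L * (1 - 3 / (2 * w))) \<le> X"
        using mult_left_mono [OF A_ge, of "real K"] K(2) by simp
      then have *: "real K * real J * (1 - 3 / (2 * w)) \<le> u"
        using L(3) by (simp add: u_def field_simps)
      have "1 \<le> (1 - 3 / (2 * w)) * (1 + 3 / w)" using w by (simp add: field_simps)
      then have "real K * real J \<le> real K * real J * ((1 - 3 / (2 * w)) * (1 + 3 / w))"
        using mult_left_mono [of 1 _ "real K * real J"] by simp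
      also have "\<dots> \<le> u * (1 + 3 / w)"
        using mult_right_mono [OF *, of "1 + 3 / w"] w by (simp add: mult.assoc)
      finally show ?thesis .
    qed
    define T where "T = ln u + ln w + 4"
    \<comment> \<open>\<open>L \<le> 2 * w * J\<close> turns \<open>L * K\<close> into a multiple of
      \<open>w * (K * J)\<close>, and \<open>K * J \<le> 2 * u\<close>, so \<open>ln w\<close>
      appears instead of \<open>ln L\<close>. Rounding 20 up to \<open>32 = 2 ^ 5\<close> gives
      \<open>5 * ln 2 < 4\<close>.\<close>
    have ln_le_T: "ln (5 * L * real K) \<le> T"
    proof -
      have "5 * L * real K \<le> 10 * w * (real K * real J)"
        using mult_right_mono [OF L_le, of "5 * real K"] by (simp add: algebra_simps)
      also have "\<dots> \<le> 10 * w * (u * 2)"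
      proof -
        have "u * (1 + 3 / w) \<le> u * 2" using u w by (intro mult_left_mono) (auto simp: field_simps)
        then show ?thesis using KJ w by (intro mult_left_mono) auto
      qed
      also have "\<dots> \<le> 32 * (u * w)" using u w by simp
      finally have "ln (5 * L * real K) \<le> ln (32 * (u * w))" using L(3) K(1) u w by simp
      also have "\<dots> = 5 * ln 2 + ln u + ln w"
        using u w ln_realpow [of 2 5] by (simp add: ln_mult)
      also have "\<dots> \<le> T" using ln2_le_25_over_36 by (simp add: T_def)
      finally show ?thesis .
    qed
    \<comment> \<open>The crude bound \<open>T \<le> 3 * w\<close> makes the correction
      \<open>3 * T / w\<close> bounded by 9; nonnegativity allows multiplying the bound on
      \<open>K * J\<close> by \<open>T\<close>.\<close>
    have T: "0 \<le> T" "T \<le> 3 * w"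
    proof -
      have "1 \<le> L * real K" using mult_mono [of 1 L 1 "real K"] L(3) K(1) by simp
      then have "1 \<le> 5 * (L * real K)" by linarith
      then have "0 \<le> ln (5 * L * real K)" by (intro ln_ge_zero) (simp only: mult.assoc)
      then show "0 \<le> T" using ln_le_T by linarith
      have "ln u \<le> w" using u by (simp add: w_def)
      moreover have "ln w \<le> w" using w by (simp add: ln_bound)
      ultimately show "T \<le> 3 * w" using w by (simp add: T_def)
    qed
    have "real K * real J * ln (5 * L * real K) \<le> real K * real J * T"
      using ln_le_T by (intro mult_left_mono) auto
    also have "\<dots> \<le> u * (1 + 3 / w) * T" using KJ T(1) by (rule mult_right_mono)
    also have "\<dots> = u * T + u * (3 * (T / w))" by (simp add: algebra_simps)
    also have "\<dots> \<le> u * T + u * 9"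
      using T(2) w u by (intro add_left_mono mult_left_mono) (auto simp: field_simps)
    finally have "X - u * (T + 10) \<le> ln (real (\<psi> x y))"
      using main K(3) A_sq sq_le_u by (simp add: algebra_simps)
    then show "ln x - ln x / ln y * (ln (ln x / ln y) + ln (ln (ln x)) + 14) \<le> ln (real (\<psi> x y))"
      by (simp add: T_def defs algebra_simps)
  qed
qed

section \<open>Comparing the iterated logarithms of \<open>x\<close> and \<open>y\<close>\<close>

theorem theorem7p1:
  fixes \<theta> :: real
  assumes "0 < \<theta>" and "\<theta> < 1"
  shows "\<exists>a y\<^sub>0 :: real. \<forall>x y :: real.
    0 < x \<longrightarrow> 0 < y \<longrightarrow> y > y\<^sub>0 \<longrightarrow>
    exp (ln y powr (1 - \<theta>)) < ln x \<longrightarrow> ln x < sqrt y \<longrightarrow>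
    ln (real (\<psi> x y)) / ln x >
      1 - (iter_ln 2 x + iter_ln 3 x + iter_ln 4 x) / ln y
        + (a + iter_ln 2 y + iter_ln 3 y) / ln y"
proof -
  define \<alpha> where "\<alpha> = 1 - \<theta>"
  have \<alpha>: "0 < \<alpha>" using assms by (simp add: \<alpha>_def)
  obtain L\<^sub>0 where L\<^sub>0:
    "\<And>x y. \<lbrakk>0 < x; 0 < y; L\<^sub>0 \<le> ln y; 12 \<le> ln (ln x); ln y ^ 3 \<le> ln x; ln x \<le> sqrt y\<rbrakk> \<Longrightarrow>
       ln x - ln x / ln y * (ln (ln x / ln y) + ln (ln (ln x)) + 14) \<le> ln (real (\<psi> x y))"
    using smooth_count_lower_bound by blast
  \<comment> \<open>Since \<open>ln x > exp (L powr \<alpha>)\<close>, the first two facts supply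
    \<open>12 \<le> ln (ln x)\<close> and the cubic hypothesis. \<open>1 < L\<close> keeps
    \<open>ln L\<close> positive, so that \<open>ln (ln L)\<close> is genuine.\<close>
  have "eventually (\<lambda>L::real. 12 \<le> L powr \<alpha>) at_top" using \<alpha> by real_asymp
  moreover have "eventually (\<lambda>L::real. L ^ 3 \<le> exp (L powr \<alpha>)) at_top" using \<alpha> by real_asymp
  moreover have "eventually (\<lambda>L::real. L\<^sub>0 \<le> L) at_top" by (rule eventually_ge_at_top)
  moreover have "eventually (\<lambda>L::real. 1 < L) at_top" by (rule eventually_gt_at_top)
  ultimately have "eventually (\<lambda>L::real. 12 \<le> L powr \<alpha> \<and> L ^ 3 \<le> exp (L powr \<alpha>) \<and> L\<^sub>0 \<le> L \<and> 1 < L) at_top"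
    by eventually_elim simp
  then obtain L\<^sub>1 where L\<^sub>1:
    "\<And>L. L \<ge> L\<^sub>1 \<Longrightarrow> 12 \<le> L powr \<alpha> \<and> L ^ 3 \<le> exp (L powr \<alpha>) \<and> L\<^sub>0 \<le> L \<and> 1 < L"
    unfolding eventually_at_top_linorder by blast
  show ?thesis
  \<comment> \<open>The witnesses are fixed by unification below: \<open>exp L\<^sub>1\<close> for
    \<open>y\<^sub>0\<close> and \<open>ln \<alpha> - 15\<close> for \<open>a\<close>.\<close>
  proof (intro exI allI impI)
    fix x y :: real
    assume xy: "0 < x" "0 < y" "exp L\<^sub>1 < y" and lower: "exp (ln y powr (1 - \<theta>)) < ln x"
      and upper: "ln x < sqrt y"
    define L X w where "L = ln y" and "X = ln x" and "w = ln X"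
    have "L\<^sub>1 \<le> L" using xy by (simp add: L_def ln_ge_iff)
    then have L: "12 \<le> L powr \<alpha>" "L ^ 3 \<le> exp (L powr \<alpha>)" "L\<^sub>0 \<le> L" "1 < L"
      using L\<^sub>1 by auto
    have X: "exp (L powr \<alpha>) < X" using lower by (simp add: L_def X_def \<alpha>_def)
    then have X_pos: "0 < X" by (meson exp_gt_zero less_trans)
    then have w: "L powr \<alpha> < w" using X ln_less_cancel_iff [of "exp (L powr \<alpha>)" X]
      by (simp add: w_def)
    have main: "X - X / L * (ln (X / L) + ln w + 14) \<le> ln (real (\<psi> x y))"
      using L\<^sub>0 [of x y] xy upper L X w by (simp add: L_def X_def w_def)
    \<comment> \<open>Taking logarithms twice in \<open>L powr \<alpha> < w\<close> bounds
      \<open>ln (ln w) - ln (ln L)\<close> below by \<open>ln \<alpha>\<close>. This pays for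
      inserting both terms into the bound; 15 absorbs the 14.\<close>
    have "\<alpha> * ln L < ln w"
      using w L ln_less_cancel_iff [of "L powr \<alpha>" w] by (simp add: ln_powr)
    moreover have "0 < \<alpha> * ln L" using \<alpha> L by simp
    ultimately have "ln (\<alpha> * ln L) < ln (ln w)" by simp
    then have "ln \<alpha> + ln (ln L) < ln (ln w)" using \<alpha> L by (simp add: ln_mult)
    then have "ln (X / L) + ln w + 14 < w + ln w + ln (ln w) - (ln \<alpha> - 15 + ln L + ln (ln L))"
      using X_pos L by (simp add: ln_div w_def)
    then have "X - X / L * (w + ln w + ln (ln w) - (ln \<alpha> - 15 + ln L + ln (ln L))) < ln (real (\<psi> x y))"
      using main X_pos L by (smt (verit) divide_pos_pos mult_strict_left_mono)
    then have "(X - X / L * (w + ln w + ln (ln w) - (ln \<alpha> - 15 + ln L + ln (ln L)))) / X < ln (real (\<psi> x y)) / X"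
      using X_pos by (rule divide_strict_right_mono)
    moreover have "(X - X / L * (D - E)) / X = 1 - D / L + E / L" for D E
      using X_pos L by (simp add: field_simps)
    ultimately have "1 - (w + ln w + ln (ln w)) / L + (ln \<alpha> - 15 + ln L + ln (ln L)) / L < ln (real (\<psi> x y)) / X"
      by simp
    then show "1 - (iter_ln 2 x + iter_ln 3 x + iter_ln 4 x) / ln y
        + (ln \<alpha> - 15 + iter_ln 2 y + iter_ln 3 y) / ln y < ln (real (\<psi> x y)) / ln x"
      by (simp add: iter_ln_def eval_nat_numeral L_def X_def w_def)
  qed
qed
end
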